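(* Let $\mathbb{H}\cong\mathbb{R}^3$ be the Heisenberg group with multiplication $(x_1,y_1,z_1)\star(x_2,y_2,z_2)=\big(x_1+x_2,\,y_1+y_2,\,z_1+z_2+\frac12(x_1y_2-y_1x_2)\big)$ and let $$X=\frac{\partial}{\partial x}-\frac12y\frac{\partial}{\partial z},\qquad Y=\frac{\partial}{\partial y}+\frac12x\frac{\partial}{\partial z},\qquad Z=[X,Y]=\frac{\partial}{\partial z}.$$ Let $\mathcal{H}_q=\operatorname{Span}\{X(q),Y(q)\}$ with the inner product $\langle\cdot,\cdot\rangle$ making $\{X(q),Y(q)\}$ orthonormal. For $\lambda>0$ let $g$ be the compatible Riemannian metric on $\mathbb{H}$ that extends $\langle\cdot,\cdot\rangle$, makes $\{X,Y,Z\}$ an orthogonal frame and satisfies $g(Z,Z)=\lambda$. Then the horizontal sub-Laplacian corresponding to $g$ is $$\mathcal{L}=\frac12\left(X^2+Y^2\right).$$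
   Context: For a connected smooth manifold $M$ with a smooth rank-$m$ sub-bundle $\mathcal{H}\subset TM$ carrying smoothly varying inner products $\langle\cdot,\cdot\rangle_q$ on its fibers, the bundle map $\beta:T^{\ast}M\to TM$, with image $\mathcal{H}$, is defined by $\langle\beta_q(p),v\rangle_q=p(v)$ for all $p\in T^{\ast}_qM$, $v\in\mathcal{H}_q$. The Hamiltonian is $H(q,p)=\frac12\langle\beta_q(p),\beta_q(p)\rangle_q=\frac12p(\beta_q(p))$, and $\Phi_t$ is the (locally defined) flow on $T^{\ast}M$ of Hamilton's equations, in canonical coordinates $\dot q^i=\partial H/\partial p_i$, $\dot p_i=-\partial H/\partial q^i$. A Riemannian metric on $M$ is compatible if its restriction to each $\mathcal{H}_q\times\mathcal{H}_q$ is $\langle\cdot,\cdot\rangle_q$; $g$ also denotes its bundle map $TM\to T^{\ast}M$, $v\mapsto g(\cdot,v)$. $\mathcal{S}^{\mathcal{H}}_x=\{v\in\mathcal{H}_x:\langle v,v\rangle_x=1\}$ and $\mathbb{U}_x$ is the rotationally invariant probability measure on it. The horizontal sub-Laplacian corresponding to $g$ is, for $f\in C_c^\infty(M)$, $$\mathcal{L}f(x)=\int_{\mathcal{S}^{\mathcal{H}}_x}\Big\{\frac{d}{dt}\Big|_{0}\frac{d}{ds}\Big|_{0}f\big(\Phi_{t+s}(x,g(v))\big)\Big\}\,\mathbb{U}_x(dv),$$ where a function $f$ on $M$ is identified with $(x,p)\mapsto f(x)$ on $T^{\ast}M$. *)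

theory Defs
  imports "HOL-Probability.Probability"
begin

section \<open>Smooth functions\<close>

primrec Ck_on :: "nat \<Rightarrow> 'a::real_normed_vector set \<Rightarrow> ('a \<Rightarrow> 'b::real_normed_vector) \<Rightarrow> bool" where
  "Ck_on 0 S f \<longleftrightarrow> continuous_on S f"
| "Ck_on (Suc k) S f \<longleftrightarrow>
     (\<forall>x\<in>S. f differentiable (at x)) \<and>
     (\<forall>v. Ck_on k S (\<lambda>x. frechet_derivative f (at x) v))"

text \<open>Only meaningful for open \<open>S\<close>, since the derivatives are unrestricted ones.\<close>

definition smooth_fun_on :: "'a::real_normed_vector set \<Rightarrow> ('a \<Rightarrow> 'b::real_normed_vector) \<Rightarrow> bool" where
  "smooth_fun_on S f \<longleftrightarrow> (\<forall>k. Ck_on k S f)"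

definition Cc_infinity :: "('a::real_normed_vector \<Rightarrow> real) set" where
  "Cc_infinity = {f. smooth_fun_on UNIV f \<and> compact (closure {x. f x \<noteq> 0})}"

section \<open>Vector fields\<close>

definition lie_derivative :: "('a::real_normed_vector \<Rightarrow> 'a) \<Rightarrow> ('a \<Rightarrow> real) \<Rightarrow> 'a \<Rightarrow> real" where
  "lie_derivative V f x = frechet_derivative f (at x) (V x)"

definition lie_bracket :: "('a::real_normed_vector \<Rightarrow> 'a) \<Rightarrow> ('a \<Rightarrow> 'a) \<Rightarrow> 'a \<Rightarrow> 'a" where
  "lie_bracket V W x = frechet_derivative W (at x) (V x) - frechet_derivative V (at x) (W x)"

section \<open>Sub-Riemannian structures on coordinate space\<close>

text \<open>
  The manifold is \<open>real^'n\<close> with its global coordinates \<open>q $ i\<close>. Tangent vectors at \<open>q\<close> are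
  elements of \<open>real^'n\<close>; a covector is given by its canonical coordinates \<open>p $ i\<close>, so that
  the pairing \<open>p(v)\<close> is \<open>p \<bullet> v\<close>, and the cotangent bundle is \<open>(real^'n) \<times> (real^'n)\<close>.
  A fibre metric \<open>ip\<close> on a distribution \<open>H\<close> is a function \<open>ip q u v\<close> of which only the values
  with \<open>u, v \<in> H q\<close> matter.
\<close>

definition inner_product_on :: "'a::real_vector set \<Rightarrow> ('a \<Rightarrow> 'a \<Rightarrow> real) \<Rightarrow> bool" where
  "inner_product_on V b \<longleftrightarrow>
     (\<forall>u\<in>V. \<forall>v\<in>V. b u v = b v u) \<and>
     (\<forall>u\<in>V. \<forall>v\<in>V. \<forall>w\<in>V. b (u + v) w = b u w + b v w) \<and>
     (\<forall>c. \<forall>u\<in>V. \<forall>w\<in>V. b (c *\<^sub>R u) w = c * b u w) \<and>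
     (\<forall>u\<in>V. u \<noteq> 0 \<longrightarrow> b u u > 0)"

definition smooth_subbundle :: "nat \<Rightarrow> (real^'n \<Rightarrow> (real^'n) set) \<Rightarrow> bool" where
  "smooth_subbundle m H \<longleftrightarrow>
     (\<forall>q. \<exists>U V. open U \<and> q \<in> U \<and>
        (\<forall>i<m. smooth_fun_on U (V i)) \<and>
        (\<forall>x\<in>U. inj_on (\<lambda>i. V i x) {..<m} \<and> independent ((\<lambda>i. V i x) ` {..<m}) \<and>
               H x = span ((\<lambda>i. V i x) ` {..<m})))"

definition sub_riemannian ::
    "nat \<Rightarrow> (real^'n \<Rightarrow> (real^'n) set) \<Rightarrow> (real^'n \<Rightarrow> real^'n \<Rightarrow> real^'n \<Rightarrow> real) \<Rightarrow> bool" where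
  "sub_riemannian m H ip \<longleftrightarrow>
     smooth_subbundle m H \<and>
     (\<forall>q. inner_product_on (H q) (ip q)) \<and>
     (\<forall>U V W. open U \<longrightarrow> smooth_fun_on U V \<longrightarrow> smooth_fun_on U W \<longrightarrow>
        (\<forall>x\<in>U. V x \<in> H x \<and> W x \<in> H x) \<longrightarrow> smooth_fun_on U (\<lambda>x. ip x (V x) (W x)))"

definition riemannian_metric :: "(real^'n \<Rightarrow> real^'n \<Rightarrow> real^'n \<Rightarrow> real) \<Rightarrow> bool" where
  "riemannian_metric g \<longleftrightarrow>
     (\<forall>q. inner_product_on UNIV (g q)) \<and> (\<forall>u v. smooth_fun_on UNIV (\<lambda>q. g q u v))"

definition compatible ::
    "(real^'n \<Rightarrow> (real^'n) set) \<Rightarrow> (real^'n \<Rightarrow> real^'n \<Rightarrow> real^'n \<Rightarrow> real) \<Rightarrow>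
     (real^'n \<Rightarrow> real^'n \<Rightarrow> real^'n \<Rightarrow> real) \<Rightarrow> bool" where
  "compatible H ip g \<longleftrightarrow> (\<forall>q. \<forall>u\<in>H q. \<forall>v\<in>H q. g q u v = ip q u v)"

text \<open>The covector \<open>g(\<sqdot>, v)\<close>.\<close>

definition flat :: "(real^'n \<Rightarrow> real^'n \<Rightarrow> real^'n \<Rightarrow> real) \<Rightarrow> real^'n \<Rightarrow> real^'n \<Rightarrow> real^'n" where
  "flat g q v = (\<chi> i. g q (axis i 1) v)"

section \<open>The Hamiltonian flow\<close>

definition beta ::
    "(real^'n \<Rightarrow> (real^'n) set) \<Rightarrow> (real^'n \<Rightarrow> real^'n \<Rightarrow> real^'n \<Rightarrow> real) \<Rightarrow>
     real^'n \<Rightarrow> real^'n \<Rightarrow> real^'n" where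
  "beta H ip q p = (THE w. w \<in> H q \<and> (\<forall>v\<in>H q. ip q w v = p \<bullet> v))"

definition hamiltonian ::
    "(real^'n \<Rightarrow> (real^'n) set) \<Rightarrow> (real^'n \<Rightarrow> real^'n \<Rightarrow> real^'n \<Rightarrow> real) \<Rightarrow>
     real^'n \<Rightarrow> real^'n \<Rightarrow> real" where
  "hamiltonian H ip q p = 1/2 * ip q (beta H ip q p) (beta H ip q p)"

definition partial_deriv :: "'n \<Rightarrow> (real^'n \<Rightarrow> real) \<Rightarrow> real^'n \<Rightarrow> real" where
  "partial_deriv i F x = deriv (\<lambda>s. F (x + s *\<^sub>R axis i 1)) 0"

definition hamilton_solution ::
    "(real^'n \<Rightarrow> real^'n \<Rightarrow> real) \<Rightarrow> real set \<Rightarrow> (real \<Rightarrow> (real^'n) \<times> (real^'n)) \<Rightarrow> bool" where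
  "hamilton_solution Ham I c \<longleftrightarrow>
     (\<forall>t\<in>I. let q = fst (c t); p = snd (c t) in
        (c has_vector_derivative
           (\<chi> i. partial_deriv i (\<lambda>p'. Ham q p') p,
            \<chi> i. - partial_deriv i (\<lambda>q'. Ham q' p) q)) (at t))"

text \<open>
  The flow is only locally defined: \<open>hamilton_flow Ham t z\<close> is specified when the solution
  starting at \<open>z\<close> is unique and lives on an open interval containing \<open>0\<close> and \<open>t\<close>.
\<close>

definition hamilton_flow ::
    "(real^'n \<Rightarrow> real^'n \<Rightarrow> real) \<Rightarrow> real \<Rightarrow> (real^'n) \<times> (real^'n) \<Rightarrow> (real^'n) \<times> (real^'n)" where
  "hamilton_flow Ham t z =
     (THE w. \<exists>I c. open I \<and> is_interval I \<and> 0 \<in> I \<and> t \<in> I \<and>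
        hamilton_solution Ham I c \<and> c 0 = z \<and> c t = w)"

section \<open>The horizontal sub-Laplacian\<close>

definition horizontal_sphere ::
    "(real^'n \<Rightarrow> (real^'n) set) \<Rightarrow> (real^'n \<Rightarrow> real^'n \<Rightarrow> real^'n \<Rightarrow> real) \<Rightarrow>
     real^'n \<Rightarrow> (real^'n) set" where
  "horizontal_sphere H ip x = {v \<in> H x. ip x v v = 1}"

text \<open>
  A rotation of the fibre is a linear isometry of \<open>(H x, ip x)\<close>; each of them is the restriction
  of a linear map of \<open>real^'n\<close>. Orientation-reversing isometries are admitted so that the
  measure is also unique in rank 1; from rank 2 on they impose no further condition.
\<close>

definition rotation_invariant ::
    "(real^'n \<Rightarrow> (real^'n) set) \<Rightarrow> (real^'n \<Rightarrow> real^'n \<Rightarrow> real^'n \<Rightarrow> real) \<Rightarrow>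
     real^'n \<Rightarrow> (real^'n) measure \<Rightarrow> bool" where
  "rotation_invariant H ip x \<mu> \<longleftrightarrow>
     (\<forall>T. linear T \<longrightarrow> T ` H x \<subseteq> H x \<longrightarrow>
        (\<forall>u\<in>H x. \<forall>v\<in>H x. ip x (T u) (T v) = ip x u v) \<longrightarrow> distr \<mu> \<mu> T = \<mu>)"

definition uniform_on_sphere ::
    "(real^'n \<Rightarrow> (real^'n) set) \<Rightarrow> (real^'n \<Rightarrow> real^'n \<Rightarrow> real^'n \<Rightarrow> real) \<Rightarrow>
     real^'n \<Rightarrow> (real^'n) measure" where
  "uniform_on_sphere H ip x =
     (THE \<mu>. prob_space \<mu> \<and> sets \<mu> = sets (restrict_space borel (horizontal_sphere H ip x)) \<and>
        rotation_invariant H ip x \<mu>)"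

definition horizontal_sublaplacian ::
    "(real^'n \<Rightarrow> (real^'n) set) \<Rightarrow> (real^'n \<Rightarrow> real^'n \<Rightarrow> real^'n \<Rightarrow> real) \<Rightarrow>
     (real^'n \<Rightarrow> real^'n \<Rightarrow> real^'n \<Rightarrow> real) \<Rightarrow> (real^'n \<Rightarrow> real) \<Rightarrow> real^'n \<Rightarrow> real" where
  "horizontal_sublaplacian H ip g f x =
     (\<integral>v. deriv (\<lambda>t. deriv (\<lambda>s.
            f (fst (hamilton_flow (hamiltonian H ip) (t + s) (x, flat g x v)))) 0) 0
        \<partial>uniform_on_sphere H ip x)"

section \<open>The Heisenberg group\<close>

definition heis_mult :: "real^3 \<Rightarrow> real^3 \<Rightarrow> real^3" (infixl "\<star>" 70) where
  "a \<star> b = vector [a$1 + b$1, a$2 + b$2, a$3 + b$3 + 1/2 * (a$1 * b$2 - a$2 * b$1)]"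

definition heis_X :: "real^3 \<Rightarrow> real^3" where
  "heis_X q = vector [1, 0, - 1/2 * q$2]"

definition heis_Y :: "real^3 \<Rightarrow> real^3" where
  "heis_Y q = vector [0, 1, 1/2 * q$1]"

definition heis_Z :: "real^3 \<Rightarrow> real^3" where
  "heis_Z q = vector [0, 0, 1]"

definition heis_H :: "real^3 \<Rightarrow> (real^3) set" where
  "heis_H q = span {heis_X q, heis_Y q}"

lemma heis_group:
  "(a \<star> b) \<star> c = a \<star> (b \<star> c)" "0 \<star> a = a" "a \<star> 0 = a" "a \<star> (- a) = 0" "(- a) \<star> a = 0"
  by (simp_all add: heis_mult_def vec_eq_iff forall_3 vector_3 algebra_simps)

lemma vector_3_axis: "(vector [a, b, c] :: real^3) = a *\<^sub>R axis 1 1 + b *\<^sub>R axis 2 1 + c *\<^sub>R axis 3 1"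
  by (simp add: vec_eq_iff forall_3 vector_3 axis_def)

lemma heis_left_translation_has_derivative:
  "((\<star>) a has_derivative
     (\<lambda>v. vector [v$1, v$2, v$3 + 1/2 * (a$1 * v$2 - a$2 * v$1)])) (at q)"
  unfolding heis_mult_def vector_3_axis
  by (auto intro!: derivative_eq_intros bounded_linear_imp_has_derivative[OF bounded_linear_vec_nth] simp: algebra_simps)

lemma heis_left_invariant:
  "frechet_derivative ((\<star>) a) (at q) (heis_X q) = heis_X (a \<star> q)"
  "frechet_derivative ((\<star>) a) (at q) (heis_Y q) = heis_Y (a \<star> q)"
  "frechet_derivative ((\<star>) a) (at q) (heis_Z q) = heis_Z (a \<star> q)"
  by (simp_all add: frechet_derivative_at[OF heis_left_translation_has_derivative, symmetric]
      heis_X_def heis_Y_def heis_Z_def heis_mult_def vec_eq_iff forall_3 vector_3 algebra_simps)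

lemma heis_X_has_derivative: "(heis_X has_derivative (\<lambda>v. vector [0, 0, - 1/2 * v$2])) (at q)"
  unfolding heis_X_def vector_3_axis by (auto intro!: derivative_eq_intros bounded_linear_imp_has_derivative[OF bounded_linear_vec_nth])

lemma heis_Y_has_derivative: "(heis_Y has_derivative (\<lambda>v. vector [0, 0, 1/2 * v$1])) (at q)"
  unfolding heis_Y_def vector_3_axis by (auto intro!: derivative_eq_intros bounded_linear_imp_has_derivative[OF bounded_linear_vec_nth])

lemma heis_bracket: "lie_bracket heis_X heis_Y q = heis_Z q"
  by (simp add: lie_bracket_def frechet_derivative_at[OF heis_X_has_derivative, symmetric]
      frechet_derivative_at[OF heis_Y_has_derivative, symmetric]
      heis_X_def heis_Y_def heis_Z_def vec_eq_iff forall_3 vector_3)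

end

theory Submission
  imports Defs
begin

text \<open>In coordinates \<open>H = ((p\<^sub>1 - y p\<^sub>3 / 2)\<^sup>2 + (p\<^sub>2 + x p\<^sub>3 / 2)\<^sup>2) / 2\<close>. For a horizontal vector \<open>v\<close>
  orthogonality to \<open>Z\<close> gives \<open>p\<^sub>3 = g(Z, v) = 0\<close>, and then \<open>p\<close> is conserved and the flow started at
  \<open>(x, g(v))\<close> projects to the straight line \<open>x + t v\<close>. Hence the integrand is the second
  derivative of \<open>f\<close> in the direction \<open>v = c X(x) + s Y(x)\<close>, a quadratic form in \<open>(c, s)\<close>, whose
  average over the circle is half its trace.\<close>

section \<open>The uniform measure on the unit circle\<close>

text \<open>The interval is one full period of \<open>cis\<close>, so rotations and conjugation of
  the circle become shifts and reflections of Lebesgue measure on periodic sets of angles.\<close>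

definition circle_measure :: "complex measure" where
  "circle_measure = distr (uniform_measure lborel {0..<2*pi}) borel cis"

lemma cis_borel_measurable [measurable]: "cis \<in> borel_measurable borel"
  by (intro borel_measurable_continuous_onI continuous_on_cis continuous_on_id)

lemma sets_circle_measure [measurable_cong, simp]: "sets circle_measure = sets borel"
  by (simp add: circle_measure_def)

lemma space_circle_measure [simp]: "space circle_measure = UNIV"
  by (simp add: circle_measure_def)

lemma prob_space_circle_measure: "prob_space circle_measure"
  unfolding circle_measure_def
  by (intro prob_space.prob_space_distr prob_space_uniform_measure) auto

lemma AE_circle_measure_norm: "AE z in circle_measure. norm z = 1"
  unfolding circle_measure_def by (subst AE_distr_iff) auto

section \<open>Lebesgue measure of periodic sets\<close>

lemma emeasure_lborel_translate:
  fixes A :: "real set"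
  assumes [measurable]: "A \<in> sets borel"
  shows "emeasure lborel {t. c + t \<in> A} = emeasure lborel A"
proof -
  have "emeasure lborel A = emeasure (distr lborel borel ((+) c)) A"
    by (simp add: lborel_distr_plus)
  also have "\<dots> = emeasure lborel {t. c + t \<in> A}"
    by (subst emeasure_distr) (auto simp: vimage_def)
  finally show ?thesis by simp
qed

lemma emeasure_lborel_reflect:
  fixes A :: "real set"
  assumes [measurable]: "A \<in> sets borel"
  shows "emeasure lborel {t. - t \<in> A} = emeasure lborel A"
proof -
  have "emeasure lborel A = emeasure (distr lborel borel uminus) A"
    by (simp add: lborel_distr_uminus)
  also have "\<dots> = emeasure lborel {t. - t \<in> A}"
    by (subst emeasure_distr) (auto simp: vimage_def)
  finally show ?thesis by simp
qed

text \<open>Shifting turns the window into \<open>{a..<a+T}\<close>. Its overhang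
  \<open>{T..<a+T}\<close>, moved back by one period, fills exactly the missing piece
  \<open>{0..<a}\<close>.\<close>

lemma emeasure_periodic_shift:
  fixes B :: "real set"
  assumes [measurable]: "B \<in> sets borel"
    and per: "\<And>t. t + T \<in> B \<longleftrightarrow> t \<in> B" and a: "0 \<le> a" "a < T"
  shows "emeasure lborel ({0..<T} \<inter> {t. a + t \<in> B}) = emeasure lborel ({0..<T} \<inter> B)"
proof -
  have "emeasure lborel ({0..<T} \<inter> {t. a + t \<in> B}) = emeasure lborel {t. a + t \<in> {a..<a+T} \<inter> B}"
    by (rule arg_cong[where f="emeasure lborel"]) auto
  also have "\<dots> = emeasure lborel ({a..<a+T} \<inter> B)"
    by (rule emeasure_lborel_translate) auto
  also have "{a..<a+T} \<inter> B = ({a..<T} \<inter> B) \<union> ({T..<a+T} \<inter> B)"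
    using a by auto
  also have "emeasure lborel \<dots> = emeasure lborel ({a..<T} \<inter> B) + emeasure lborel ({T..<a+T} \<inter> B)"
    by (rule plus_emeasure[symmetric]) auto
  also have "emeasure lborel ({T..<a+T} \<inter> B) = emeasure lborel {t. T + t \<in> {T..<a+T} \<inter> B}"
    by (rule emeasure_lborel_translate[symmetric]) auto
  also have "{t. T + t \<in> {T..<a+T} \<inter> B} = {0..<a} \<inter> B"
    using per by (auto simp: add.commute)
  also have "emeasure lborel ({a..<T} \<inter> B) + emeasure lborel ({0..<a} \<inter> B)
      = emeasure lborel (({a..<T} \<inter> B) \<union> ({0..<a} \<inter> B))"
    by (rule plus_emeasure) auto
  also have "({a..<T} \<inter> B) \<union> ({0..<a} \<inter> B) = {0..<T} \<inter> B"
    using a by auto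
  finally show ?thesis .
qed

text \<open>Reflection sends the window to \<open>{-T<..0}\<close> and one period more to
  \<open>{0<..T}\<close>, which differs from \<open>{0..<T}\<close> only in the endpoints, a null
  set.\<close>

lemma emeasure_periodic_reflect:
  fixes B :: "real set"
  assumes [measurable]: "B \<in> sets borel" and per: "\<And>t. t + T \<in> B \<longleftrightarrow> t \<in> B"
  shows "emeasure lborel ({0..<T} \<inter> {t. - t \<in> B}) = emeasure lborel ({0..<T} \<inter> B)"
proof -
  have "emeasure lborel ({0..<T} \<inter> {t. - t \<in> B}) = emeasure lborel {t. - t \<in> {-T<..0} \<inter> B}"
    by (rule arg_cong[where f="emeasure lborel"]) auto
  also have "\<dots> = emeasure lborel ({-T<..0} \<inter> B)"
    by (rule emeasure_lborel_reflect) auto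
  also have "\<dots> = emeasure lborel {t. - T + t \<in> {-T<..0} \<inter> B}"
    by (rule emeasure_lborel_translate[symmetric]) auto
  also have "{t. - T + t \<in> {-T<..0} \<inter> B} = {0<..T} \<inter> B"
    using per[of "t - T" for t] by (auto simp: algebra_simps)
  also have "emeasure lborel ({0<..T} \<inter> B) = emeasure lborel ({0..<T} \<inter> B)"
    using AE_lborel_singleton[of 0] AE_lborel_singleton[of T]
    by (intro emeasure_eq_AE) (auto elim!: eventually_elim2)
  finally show ?thesis .
qed

lemma emeasure_circle_measure:
  assumes [measurable]: "A \<in> sets borel"
  shows "emeasure circle_measure A
    = emeasure lborel ({0..<2*pi} \<inter> {t. cis t \<in> A}) / ennreal (2*pi)"
proof -
  have "{t. cis t \<in> A} \<in> sets borel" by measurable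
  then show ?thesis
    unfolding circle_measure_def
    by (subst emeasure_distr) (auto simp: vimage_def)
qed

lemma circle_measure_mult:
  assumes "norm z = 1"
  shows "distr circle_measure borel ((*) z) = circle_measure"
proof (rule measure_eqI)
  fix A assume "A \<in> sets (distr circle_measure borel ((*) z))"
  then have A [measurable]: "A \<in> sets borel" by simp
  \<comment> \<open>\<open>Arg2pi\<close> takes values in \<open>[0, 2*pi)\<close>, the range of
    shifts that \<open>emeasure_periodic_shift\<close> covers.\<close>
  obtain a where a: "0 \<le> a" "a < 2*pi" "z = cis a"
  proof (rule that)
    show "0 \<le> Arg2pi z" "Arg2pi z < 2*pi" using Arg2pi[of z] by auto
    show "z = cis (Arg2pi z)" using assms complex_norm_eq_1_exp[of z] by (simp add: cis_conv_exp)
  qed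
  have B: "{t. cis t \<in> A} \<in> sets borel" by measurable
  have "emeasure (distr circle_measure borel ((*) z)) A = emeasure circle_measure {w. z * w \<in> A}"
    by (subst emeasure_distr) (auto simp: vimage_def)
  also have "\<dots> = emeasure lborel ({0..<2*pi} \<inter> {t. a + t \<in> {t. cis t \<in> A}}) / ennreal (2*pi)"
    by (subst emeasure_circle_measure) (auto simp: a cis_mult)
  also have "\<dots> = emeasure circle_measure A"
    by (subst emeasure_periodic_shift[OF B _ a(1,2)])
      (simp_all add: emeasure_circle_measure cis.ctr)
  finally show "emeasure (distr circle_measure borel ((*) z)) A = emeasure circle_measure A" .
qed simp

lemma circle_measure_cnj: "distr circle_measure borel cnj = circle_measure"
proof (rule measure_eqI)
  fix A assume "A \<in> sets (distr circle_measure borel cnj)"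
  then have A [measurable]: "A \<in> sets borel" by simp
  have [measurable]: "cnj \<in> borel_measurable borel"
    by (intro borel_measurable_continuous_onI continuous_intros)
  have B: "{t. cis t \<in> A} \<in> sets borel" by measurable
  have "emeasure (distr circle_measure borel cnj) A = emeasure circle_measure {w. cnj w \<in> A}"
    by (subst emeasure_distr) (auto simp: vimage_def)
  also have "\<dots> = emeasure lborel ({0..<2*pi} \<inter> {t. - t \<in> {t. cis t \<in> A}}) / ennreal (2*pi)"
    by (subst emeasure_circle_measure) (auto simp: cis_cnj)
  also have "\<dots> = emeasure circle_measure A"
    by (subst emeasure_periodic_reflect[OF B])
      (simp_all add: emeasure_circle_measure cis.ctr)
  finally show "emeasure (distr circle_measure borel cnj) A = emeasure circle_measure A" .
qed simp

text \<open>A continuous function may be unbounded on the plane, but it is bounded on the compact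
  unit circle, which carries all the mass.\<close>

lemma integrable_circle_measure:
  fixes h :: "complex \<Rightarrow> real"
  assumes "continuous_on UNIV h"
  shows "integrable circle_measure h"
proof -
  interpret prob_space circle_measure by (rule prob_space_circle_measure)
  have "bounded (h ` sphere 0 1)"
    by (intro compact_imp_bounded compact_continuous_image continuous_on_subset[OF assms]) auto
  then obtain C where C: "\<And>z. norm z = 1 \<Longrightarrow> norm (h z) \<le> C"
    unfolding bounded_iff by (metis image_eqI mem_sphere_0)
  show ?thesis
  proof (rule integrable_const_bound[where B=C])
    show "AE z in circle_measure. norm (h z) \<le> C"
      using AE_circle_measure_norm by eventually_elim (rule C)
    show "h \<in> borel_measurable circle_measure"
      using borel_measurable_continuous_onI[OF assms] by simp
  qed
qed

text \<open>The second moments need no computation: multiplication by \<open>\<i>\<close> maps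
  \<open>(Re, Im)\<close> to \<open>(- Im, Re)\<close>.\<close>

lemma circle_measure_moments:
  "(\<integral>z. (Re z)\<^sup>2 \<partial>circle_measure) = 1/2"
  "(\<integral>z. (Im z)\<^sup>2 \<partial>circle_measure) = 1/2"
  "(\<integral>z. Re z * Im z \<partial>circle_measure) = 0"
proof -
  interpret prob_space circle_measure by (rule prob_space_circle_measure)
  have rot: "(\<integral>z. h (\<i> * z) \<partial>circle_measure) = (\<integral>z. h z \<partial>circle_measure)"
    if "continuous_on UNIV h" for h :: "complex \<Rightarrow> real"
    using borel_measurable_continuous_onI[OF that] circle_measure_mult[of \<i>]
      integral_distr[of "(*) \<i>" circle_measure borel h]
    by simp
  have "(\<integral>z. (Re z)\<^sup>2 \<partial>circle_measure) + (\<integral>z. (Im z)\<^sup>2 \<partial>circle_measure)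
      = (\<integral>z. (Re z)\<^sup>2 + (Im z)\<^sup>2 \<partial>circle_measure)"
    by (intro Bochner_Integration.integral_add[symmetric] integrable_circle_measure continuous_intros)
  also have "\<dots> = (\<integral>z. 1 \<partial>circle_measure)"
    using AE_circle_measure_norm
    by (intro integral_cong_AE) (auto simp: cmod_def elim: eventually_mono)
  also have "\<dots> = 1" using prob_space by simp
  finally have "(\<integral>z. (Re z)\<^sup>2 \<partial>circle_measure) + (\<integral>z. (Im z)\<^sup>2 \<partial>circle_measure) = 1" .
  moreover have "(\<integral>z. (Im z)\<^sup>2 \<partial>circle_measure) = (\<integral>z. (Re z)\<^sup>2 \<partial>circle_measure)"
    using rot[of "\<lambda>z. (Re z)\<^sup>2"] by (simp add: continuous_intros)
  ultimately show "(\<integral>z. (Re z)\<^sup>2 \<partial>circle_measure) = 1/2"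
    and "(\<integral>z. (Im z)\<^sup>2 \<partial>circle_measure) = 1/2" by simp_all
  \<comment> \<open>The quarter turn changes the sign of the integrand, so the integral equals its
    own negative.\<close>
  show "(\<integral>z. Re z * Im z \<partial>circle_measure) = 0"
    using rot[of "\<lambda>z. Re z * Im z"] by (simp add: continuous_intros mult.commute)
qed

section \<open>Complex coordinates on the horizontal planes\<close>

text \<open>In these coordinates rotations of the horizontal plane become multiplications by unit
  complex numbers.\<close>

definition heis_frame :: "real^3 \<Rightarrow> complex \<Rightarrow> real^3" where
  "heis_frame x z = Re z *\<^sub>R heis_X x + Im z *\<^sub>R heis_Y x"

text \<open>The first two components of \<open>heis_X x\<close> and \<open>heis_Y x\<close> are the
  standard basis for every \<open>x\<close>, so this one map is a left inverse of every
  \<open>heis_frame x\<close>.\<close>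

definition heis_coord :: "real^3 \<Rightarrow> complex" where
  "heis_coord v = Complex (v$1) (v$2)"

lemma heis_frame_nth:
  "heis_frame x z $ 1 = Re z" "heis_frame x z $ 2 = Im z"
  "heis_frame x z $ 3 = 1/2 * (x$1 * Im z - x$2 * Re z)"
  by (simp_all add: heis_frame_def heis_X_def heis_Y_def vector_3 algebra_simps)

lemma heis_coord_frame [simp]: "heis_coord (heis_frame x z) = z"
  by (simp add: heis_coord_def heis_frame_nth)

lemma linear_heis_frame: "linear (heis_frame x)"
  by (rule linearI) (simp_all add: heis_frame_def algebra_simps)

lemma linear_heis_coord: "linear heis_coord"
  by (rule linearI) (simp_all add: heis_coord_def complex_eq_iff)

lemma heis_H_eq: "heis_H x = range (heis_frame x)"
proof
  have "heis_frame x 1 = heis_X x" "heis_frame x \<i> = heis_Y x"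
    by (simp_all add: heis_frame_def)
  then have "{heis_X x, heis_Y x} \<subseteq> range (heis_frame x)"
    by (metis empty_subsetI insert_subset rangeI)
  then show "heis_H x \<subseteq> range (heis_frame x)"
    unfolding heis_H_def
    by (intro span_minimal linear_subspace_image linear_heis_frame) auto
  show "range (heis_frame x) \<subseteq> heis_H x"
    unfolding heis_H_def heis_frame_def by (auto intro!: span_add span_scale intro: span_base)
qed

lemma heis_frame_in_H [simp]: "heis_frame x z \<in> heis_H x"
  by (simp add: heis_H_eq)

lemma heis_frame_1 [simp]: "heis_frame x 1 = heis_X x"
  and heis_frame_ii [simp]: "heis_frame x \<i> = heis_Y x"
  by (simp_all add: heis_frame_def)

lemma heis_frame_measurable [measurable]: "heis_frame x \<in> borel_measurable borel"
  by (intro borel_measurable_continuous_onI linear_continuous_on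
      linear_conv_bounded_linear[THEN iffD1] linear_heis_frame)

lemma heis_coord_measurable [measurable]: "heis_coord \<in> borel_measurable borel"
  by (intro borel_measurable_continuous_onI linear_continuous_on
      linear_conv_bounded_linear[THEN iffD1] linear_heis_coord)

lemma heis_frame_coord: "v \<in> heis_H x \<Longrightarrow> heis_frame x (heis_coord v) = v"
  by (auto simp: heis_H_eq)

text \<open>An orthonormal basis identifies the fibre with the Euclidean plane; later arguments use
  \<open>ip\<close> through this isometry.\<close>

lemma inner_product_on_heis_frame:
  assumes ip: "inner_product_on (heis_H x) b"
    and "b (heis_X x) (heis_X x) = 1" "b (heis_Y x) (heis_Y x) = 1" "b (heis_X x) (heis_Y x) = 0"
  shows "b (heis_frame x z) (heis_frame x w) = z \<bullet> w"
proof -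
  note H = heis_frame_in_H[of x 1, simplified] heis_frame_in_H[of x \<i>, simplified]
  have sub: "subspace (heis_H x)" by (simp add: heis_H_def)
  have sc: "c *\<^sub>R heis_X x \<in> heis_H x" "c *\<^sub>R heis_Y x \<in> heis_H x" for c
    using sub H by (auto intro: subspace_scale)
  have comm: "b u v = b v u" and add: "b (u + v) w = b u w + b v w"
    and scale: "b (c *\<^sub>R u) w = c * b u w"
    if "u \<in> heis_H x" "v \<in> heis_H x" "w \<in> heis_H x" for u v w c
    using ip that unfolding inner_product_on_def by auto
  \<comment> \<open>Linearity is given in the first argument only; the second one is reached through
    symmetry.\<close>
  have left: "b (heis_frame x z) v = Re z * b (heis_X x) v + Im z * b (heis_Y x) v"
    if "v \<in> heis_H x" for v z
    unfolding heis_frame_def using that H sc by (simp add: add scale)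
  show ?thesis
    using left[of "heis_frame x w" z] left[of "heis_X x" w] left[of "heis_Y x" w] H
      comm[of "heis_X x" "heis_frame x w"] comm[of "heis_Y x" "heis_frame x w"]
      comm[of "heis_X x" "heis_Y x"] assms(2-)
    by (simp add: inner_complex_def)
qed

lemma horizontal_sphere_heis:
  assumes "\<And>z w. ip x (heis_frame x z) (heis_frame x w) = z \<bullet> w"
  shows "horizontal_sphere heis_H ip x = heis_frame x ` sphere 0 1"
proof -
  have "z \<bullet> z = 1 \<longleftrightarrow> norm z = 1" for z :: complex
    by (simp add: norm_eq_1)
  then show ?thesis
    unfolding horizontal_sphere_def heis_H_eq by (auto simp: assms)
qed

text \<open>Orthogonal maps of the plane are rotations or reflections: the image of \<open>1\<close>
  determines the image of \<open>\<i>\<close> up to sign.\<close>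

lemma isometry_of_heis_H:
  assumes ip: "\<And>z w. ip x (heis_frame x z) (heis_frame x w) = z \<bullet> w"
    and T: "linear T" "T ` heis_H x \<subseteq> heis_H x"
      "\<forall>u\<in>heis_H x. \<forall>v\<in>heis_H x. ip x (T u) (T v) = ip x u v"
  obtains z where "norm z = 1" "\<And>u. T (heis_frame x u) = heis_frame x (z * u)"
  | z where "norm z = 1" "\<And>u. T (heis_frame x u) = heis_frame x (z * cnj u)"
proof -
  obtain z w where zw: "T (heis_frame x 1) = heis_frame x z" "T (heis_frame x \<i>) = heis_frame x w"
  proof -
    have "T (heis_frame x u) \<in> range (heis_frame x)" for u
      using T(2) unfolding heis_H_eq by blast
    with that show thesis by blast
  qed
  have iso: "ip x (T (heis_frame x u)) (T (heis_frame x v)) = u \<bullet> v" for u v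
    using T(3) ip by simp
  have rel: "z \<bullet> z = 1" "w \<bullet> w = 1" "z \<bullet> w = 0"
    using iso[of 1 1] iso[of \<i> \<i>] iso[of 1 \<i>] unfolding zw ip by (simp_all add: inner_complex_def)
  then have nz: "norm z = 1" by (simp add: norm_eq_1)
  \<comment> \<open>Multiplication by \<open>cnj z\<close> rotates \<open>z\<close> back to
    \<open>1\<close>, so \<open>w\<close> becomes a unit number orthogonal to \<open>1\<close>,
    which leaves only \<i> and its negative.\<close>
  have "(cnj z * w) \<bullet> 1 = 0" "norm (cnj z * w) = 1"
    using rel by (simp_all add: inner_complex_def norm_mult nz norm_eq_1)
  then have "cnj z * w = \<i> \<or> cnj z * w = - \<i>"
    by (auto simp: complex_eq_iff cmod_def inner_complex_def power2_eq_1_iff)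
  moreover have "z * cnj z = 1"
    using complex_norm_square[of z] nz by simp
  then have "z * (cnj z * w) = w"
    by (simp add: mult.assoc[symmetric])
  ultimately have w: "w = z * \<i> \<or> w = z * - \<i>" by metis
  have lin: "T (heis_frame x u) = heis_frame x (Re u *\<^sub>R z + Im u *\<^sub>R w)" for u
  proof -
    have "heis_frame x u = Re u *\<^sub>R heis_frame x 1 + Im u *\<^sub>R heis_frame x \<i>"
      by (simp add: heis_frame_def)
    then show ?thesis
      using zw by (simp add: linear_add[OF T(1)] linear_scale[OF T(1)]
          linear_add[OF linear_heis_frame] linear_scale[OF linear_heis_frame] del: heis_frame_1 heis_frame_ii)
  qed
  from w show thesis
  proof
    assume "w = z * \<i>"
    then have "Re u *\<^sub>R z + Im u *\<^sub>R w = z * u" for u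
      by (simp add: complex_eq_iff algebra_simps)
    with lin nz that(1) show thesis by simp
  next
    assume "w = z * - \<i>"
    then have "Re u *\<^sub>R z + Im u *\<^sub>R w = z * cnj u" for u
      by (simp add: complex_eq_iff algebra_simps)
    with lin nz that(2) show thesis by simp
  qed
qed

section \<open>The rotation invariant measure\<close>

lemma heis_frame_sphere_borel: "heis_frame x ` sphere 0 1 \<in> sets borel"
proof -
  have "compact (heis_frame x ` sphere 0 1)"
    by (intro compact_continuous_image linear_continuous_on
        linear_conv_bounded_linear[THEN iffD1] linear_heis_frame) auto
  then show ?thesis by (intro borel_closed compact_imp_closed)
qed

text \<open>\<open>circle_measure\<close> lives on all of \<open>complex\<close>; the null set off the unit circle is sent to \<open>X\<close>
  to obtain a map into the sphere.\<close>

definition heis_sphere_measure :: "real^3 \<Rightarrow> (real^3) measure" where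
  "heis_sphere_measure x =
     distr circle_measure (restrict_space borel (heis_frame x ` sphere 0 1))
       (\<lambda>z. heis_frame x (if norm z = 1 then z else 1))"

lemma sphere_param_measurable [measurable]:
  "(\<lambda>z. heis_frame x (if norm z = 1 then z else 1))
    \<in> measurable circle_measure (restrict_space borel (heis_frame x ` sphere 0 1))"
  by (rule measurable_restrict_space2) (auto, measurable)

lemma sets_heis_sphere_measure [simp]:
  "sets (heis_sphere_measure x) = sets (restrict_space borel (heis_frame x ` sphere 0 1))"
  by (simp add: heis_sphere_measure_def)

lemma prob_space_heis_sphere_measure: "prob_space (heis_sphere_measure x)"
  unfolding heis_sphere_measure_def
  by (intro prob_space.prob_space_distr prob_space_circle_measure) measurable

text \<open>The case distinction in the parametrization changes it only on a null set, so measures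
  can be computed with \<open>heis_frame x\<close> alone.\<close>

lemma emeasure_heis_sphere_measure:
  assumes "A \<in> sets (restrict_space borel (heis_frame x ` sphere 0 1))"
  shows "emeasure (heis_sphere_measure x) A = emeasure circle_measure {z. heis_frame x z \<in> A}"
proof -
  from assms have A [measurable]: "A \<in> sets borel"
    by (simp add: sets_restrict_space_iff heis_frame_sphere_borel)
  have "emeasure (heis_sphere_measure x) A
      = emeasure circle_measure {z. heis_frame x (if norm z = 1 then z else 1) \<in> A}"
    unfolding heis_sphere_measure_def
    by (subst emeasure_distr[OF sphere_param_measurable assms]) (auto simp: vimage_def)
  also have "\<dots> = emeasure circle_measure {z. heis_frame x z \<in> A}"
    using AE_circle_measure_norm
    by (intro emeasure_eq_AE) (auto elim: eventually_mono)
  finally show ?thesis .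
qed

lemma integral_heis_sphere_measure:
  fixes h :: "real^3 \<Rightarrow> real"
  assumes [measurable]: "h \<in> borel_measurable borel"
  shows "(\<integral>v. h v \<partial>heis_sphere_measure x) = (\<integral>z. h (heis_frame x z) \<partial>circle_measure)"
proof -
  have "(\<integral>v. h v \<partial>heis_sphere_measure x)
      = (\<integral>z. h (heis_frame x (if norm z = 1 then z else 1)) \<partial>circle_measure)"
    unfolding heis_sphere_measure_def
    by (rule integral_distr[OF sphere_param_measurable]) (intro measurable_restrict_space1 assms)
  also have "\<dots> = (\<integral>z. h (heis_frame x z) \<partial>circle_measure)"
    using AE_circle_measure_norm by (intro integral_cong_AE) (auto elim: eventually_mono)
  finally show ?thesis .
qed

lemma rotation_invariant_heis_sphere_measure:
  assumes ip: "\<And>z w. ip x (heis_frame x z) (heis_frame x w) = z \<bullet> w"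
  shows "rotation_invariant heis_H ip x (heis_sphere_measure x)"
  unfolding rotation_invariant_def
proof (intro allI impI)
  fix T :: "real^3 \<Rightarrow> real^3"
  assume T: "linear T" "T ` heis_H x \<subseteq> heis_H x"
    "\<forall>u\<in>heis_H x. \<forall>v\<in>heis_H x. ip x (T u) (T v) = ip x u v"
  let ?S = "heis_frame x ` sphere 0 1" and ?U = "heis_sphere_measure x"
  \<comment> \<open>\<open>R\<close> is the isometry in complex coordinates; it stands for the
    rotation and the reflection case at once.\<close>
  obtain R where R: "\<And>u. T (heis_frame x u) = heis_frame x (R u)"
      "\<And>u. norm (R u) = norm u" "distr circle_measure borel R = circle_measure"
      "R \<in> borel_measurable borel"
  proof (rule isometry_of_heis_H[where ip=ip and x=x, OF ip T])
    fix z :: complex assume z: "norm z = 1"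
    assume "\<And>u. T (heis_frame x u) = heis_frame x (z * u)"
    with z circle_measure_mult[OF z] show thesis
      by (intro that[of "(*) z"]) (auto simp: norm_mult)
  next
    fix z :: complex assume z: "norm z = 1"
    assume *: "\<And>u. T (heis_frame x u) = heis_frame x (z * cnj u)"
    have [measurable]: "cnj \<in> borel_measurable borel"
      by (intro borel_measurable_continuous_onI continuous_intros)
    \<comment> \<open>A reflection is conjugation followed by a rotation, and each of them preserves
      the measure.\<close>
    have "distr circle_measure borel (\<lambda>u. z * cnj u)
        = distr (distr circle_measure borel cnj) borel ((*) z)"
      by (subst distr_distr) (auto simp: comp_def)
    with z * show thesis
      by (intro that[of "\<lambda>u. z * cnj u"])
        (auto simp: norm_mult circle_measure_cnj circle_measure_mult)
  qed
  note [measurable] = R(4)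
  have "continuous_on UNIV T"
    using T(1) by (intro linear_continuous_on) (simp add: linear_conv_bounded_linear)
  then have [measurable]: "T \<in> borel_measurable borel"
    by (rule borel_measurable_continuous_onI)
  have TS: "T v \<in> ?S" if "v \<in> ?S" for v
    using that R by auto
  have Tm: "T \<in> measurable ?U ?U"
    unfolding measurable_cong_sets[OF sets_heis_sphere_measure sets_heis_sphere_measure]
    using TS by (intro measurable_restrict_space3) auto
  show "distr ?U ?U T = ?U"
  proof (rule measure_eqI)
    fix A assume "A \<in> sets (distr ?U ?U T)"
    then have A: "A \<in> sets (restrict_space borel ?S)" by simp
    then have A' [measurable]: "A \<in> sets borel" and "A \<subseteq> ?S"
      by (simp_all add: sets_restrict_space_iff heis_frame_sphere_borel)
    have sp: "space ?U = ?S" using sets_eq_imp_space_eq[OF sets_heis_sphere_measure]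
      by (simp add: space_restrict_space)
    have pre: "T -` A \<inter> ?S \<in> sets (restrict_space borel ?S)"
      using measurable_sets[OF Tm] A sp by auto
    have "emeasure (distr ?U ?U T) A = emeasure ?U (T -` A \<inter> ?S)"
      using A by (subst emeasure_distr[OF Tm]) (auto simp: sp)
    also have "\<dots> = emeasure circle_measure {z. heis_frame x z \<in> T -` A \<inter> ?S}"
      by (rule emeasure_heis_sphere_measure[OF pre])
    \<comment> \<open>Intersecting with the sphere costs nothing: \<open>A\<close> lies in the
      sphere, \<open>heis_frame x\<close> is injective and \<open>R\<close> preserves the
      norm.\<close>
    also have "{z. heis_frame x z \<in> T -` A \<inter> ?S} = {z. heis_frame x (R z) \<in> A}"
    proof -
      have "norm z = 1" if "heis_frame x (R z) \<in> A" for z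
      proof -
        have "heis_frame x (R z) \<in> ?S"
          using \<open>A \<subseteq> ?S\<close> that by blast
        then obtain w where w: "norm w = 1" "heis_frame x (R z) = heis_frame x w"
          by auto
        then have "R z = w" by (metis heis_coord_frame)
        with w(1) R(2)[of z] show ?thesis by simp
      qed
      then show ?thesis by (auto simp: R(1))
    qed
    also have "emeasure circle_measure {z. heis_frame x (R z) \<in> A}
        = emeasure (distr circle_measure borel R) {z. heis_frame x z \<in> A}"
      by (subst emeasure_distr) (auto simp: vimage_def)
    also have "\<dots> = emeasure ?U A"
      by (simp add: R(3) emeasure_heis_sphere_measure[OF A])
    finally show "emeasure (distr ?U ?U T) A = emeasure ?U A" .
  qed simp
qed

text \<open>Averaging an invariant measure over all rotations (Fubini) turns it into the
  orbit measure of any point of the sphere.\<close>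

lemma rotation_invariant_unique:
  assumes ip: "\<And>z w. ip x (heis_frame x z) (heis_frame x w) = z \<bullet> w"
    and "prob_space \<mu>"
    and sets_\<mu>: "sets \<mu> = sets (restrict_space borel (heis_frame x ` sphere 0 1))"
    and inv: "rotation_invariant heis_H ip x \<mu>"
  shows "\<mu> = heis_sphere_measure x"
proof (rule measure_eqI)
  let ?S = "heis_frame x ` sphere 0 1"
  show "sets \<mu> = sets (heis_sphere_measure x)" by (simp add: sets_\<mu>)
  fix A assume A: "A \<in> sets \<mu>"
  then have A' [measurable]: "A \<in> sets borel" and "A \<subseteq> ?S"
    by (simp_all add: sets_\<mu> sets_restrict_space_iff heis_frame_sphere_borel)
  interpret \<mu>: prob_space \<mu> by fact
  interpret C: prob_space circle_measure by (rule prob_space_circle_measure)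
  interpret P: pair_sigma_finite circle_measure \<mu> ..
  have sp: "space \<mu> = ?S"
    using sets_eq_imp_space_eq[OF sets_\<mu>] by (simp add: space_restrict_space)
  have coord [measurable]: "heis_coord \<in> borel_measurable \<mu>"
    unfolding measurable_cong_sets[OF sets_\<mu> refl] by (intro measurable_restrict_space1) measurable
  \<comment> \<open>Invariance is stated for linear maps of the whole space; passing through
    \<open>heis_coord\<close> extends the rotation by \<open>z\<close> from the horizontal plane to
    such a map.\<close>
  let ?R = "\<lambda>z v. heis_frame x (z * heis_coord v)"
  have rot: "emeasure \<mu> A = (\<integral>\<^sup>+v. indicator A (?R z v) \<partial>\<mu>)" if z: "norm z = 1" for z
  proof -
    have lin: "linear (?R z)"
      by (rule linearI)
        (simp_all add: linear_add[OF linear_heis_coord] linear_scale[OF linear_heis_coord]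
          linear_add[OF linear_heis_frame] linear_scale[OF linear_heis_frame] distrib_left)
    have "ip x (?R z u) (?R z v) = ip x u v" if "u \<in> heis_H x" "v \<in> heis_H x" for u v
    proof -
      have "(z * a) \<bullet> (z * b) = (norm z)\<^sup>2 * (a \<bullet> b)" for a b
        unfolding cmod_power2 by (simp add: inner_complex_def power2_eq_square algebra_simps)
      with that z show ?thesis by (auto simp: heis_H_eq ip)
    qed
    moreover have "?R z ` heis_H x \<subseteq> heis_H x" by auto
    ultimately have "distr \<mu> \<mu> (?R z) = \<mu>"
      using inv[unfolded rotation_invariant_def, THEN spec[of _ "?R z"]] lin by blast
    moreover have "?R z \<in> measurable \<mu> \<mu>"
      unfolding measurable_cong_sets[OF refl sets_\<mu>]
      using z by (intro measurable_restrict_space2) (auto simp: sp norm_mult)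
    ultimately have "emeasure \<mu> A = (\<integral>\<^sup>+v. indicator A v \<partial>distr \<mu> \<mu> (?R z))"
      using A by simp
    also have "\<dots> = (\<integral>\<^sup>+v. indicator A (?R z v) \<partial>\<mu>)"
      using A \<open>?R z \<in> measurable \<mu> \<mu>\<close> by (intro nn_integral_distr) auto
    finally show ?thesis .
  qed
  have orbit: "(\<integral>\<^sup>+z. indicator A (?R z v) \<partial>circle_measure) = emeasure (heis_sphere_measure x) A"
    if "v \<in> space \<mu>" for v
  proof -
    have n: "norm (heis_coord v) = 1" using that by (auto simp: sp)
    \<comment> \<open>With \<open>v\<close> fixed, \<open>z\<close> now varies and is multiplied by
      the unit number \<open>heis_coord v\<close>; invariance of the circle measure removes the
      dependence on \<open>v\<close>.\<close>
    have "(\<integral>\<^sup>+z. indicator A (?R z v) \<partial>circle_measure)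
        = (\<integral>\<^sup>+z. indicator A (heis_frame x z) \<partial>distr circle_measure borel ((*) (heis_coord v)))"
      by (subst nn_integral_distr) (auto simp: mult.commute)
    also have "\<dots> = (\<integral>\<^sup>+z. indicator {z. heis_frame x z \<in> A} z \<partial>circle_measure)"
      by (simp add: circle_measure_mult[OF n] indicator_def)
    also have "\<dots> = emeasure (heis_sphere_measure x) A"
      using A by (subst nn_integral_indicator) (auto simp: emeasure_heis_sphere_measure sets_\<mu>)
    finally show ?thesis .
  qed
  have "emeasure \<mu> A = (\<integral>\<^sup>+z. emeasure \<mu> A \<partial>circle_measure)"
    by (simp add: C.emeasure_space_1[simplified])
  also have "\<dots> = (\<integral>\<^sup>+z. \<integral>\<^sup>+v. indicator A (?R z v) \<partial>\<mu> \<partial>circle_measure)"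
    using AE_circle_measure_norm by (intro nn_integral_cong_AE) (auto simp: rot elim: eventually_mono)
  also have "\<dots> = (\<integral>\<^sup>+v. \<integral>\<^sup>+z. indicator A (?R z v) \<partial>circle_measure \<partial>\<mu>)"
    by (rule P.Fubini'[symmetric]) measurable
  also have "\<dots> = (\<integral>\<^sup>+v. emeasure (heis_sphere_measure x) A \<partial>\<mu>)"
    by (intro nn_integral_cong orbit)
  also have "\<dots> = emeasure (heis_sphere_measure x) A"
    by (simp add: \<mu>.emeasure_space_1)
  finally show "emeasure \<mu> A = emeasure (heis_sphere_measure x) A" .
qed

lemma uniform_on_sphere_heis:
  assumes ip: "\<And>z w. ip x (heis_frame x z) (heis_frame x w) = z \<bullet> w"
  shows "uniform_on_sphere heis_H ip x = heis_sphere_measure x"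
  unfolding uniform_on_sphere_def horizontal_sphere_heis[where ip=ip and x=x, OF ip]
  using prob_space_heis_sphere_measure rotation_invariant_heis_sphere_measure[where ip=ip and x=x, OF ip]
    rotation_invariant_unique[where ip=ip and x=x, OF ip]
  by (intro the_equality) auto

section \<open>The Hamiltonian flow\<close>

text \<open>The vector representing \<open>p\<close> has, in an orthonormal basis, the pairings of
  \<open>p\<close> with the basis vectors as coefficients.\<close>

lemma beta_heis:
  assumes ip: "\<And>z w. ip q (heis_frame q z) (heis_frame q w) = z \<bullet> w"
  shows "beta heis_H ip q p = heis_frame q (Complex (p \<bullet> heis_X q) (p \<bullet> heis_Y q))"
  unfolding beta_def
proof (rule the_equality)
  let ?w = "Complex (p \<bullet> heis_X q) (p \<bullet> heis_Y q)"
  have pair: "p \<bullet> heis_frame q z = ?w \<bullet> z" for z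
    by (simp add: heis_frame_def inner_complex_def inner_add_right mult.commute)
  show "heis_frame q ?w \<in> heis_H q \<and> (\<forall>v\<in>heis_H q. ip q (heis_frame q ?w) v = p \<bullet> v)"
    by (auto simp: heis_H_eq ip pair)
  fix w assume w: "w \<in> heis_H q \<and> (\<forall>v\<in>heis_H q. ip q w v = p \<bullet> v)"
  then obtain z where z: "w = heis_frame q z" by (auto simp: heis_H_eq)
  with w have "z \<bullet> u = ?w \<bullet> u" for u
    by (auto simp: heis_H_eq ip pair)
  then have "z = ?w" by (metis vector_eq_rdot)
  with z show "w = heis_frame q ?w" by simp
qed

lemma hamiltonian_heis:
  assumes ip: "\<And>q z w. ip q (heis_frame q z) (heis_frame q w) = z \<bullet> w"
  shows "hamiltonian heis_H ip =
    (\<lambda>q p. 1/2 * ((p$1 - 1/2 * q$2 * p$3)\<^sup>2 + (p$2 + 1/2 * q$1 * p$3)\<^sup>2))"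
  by (intro ext)
    (simp add: hamiltonian_def beta_heis[where ip=ip, OF ip] ip inner_complex_def heis_X_def heis_Y_def
      inner_vec_def sum_3 vector_3 power2_eq_square algebra_simps)

lemma partial_deriv_eqI:
  fixes F :: "real^'n \<Rightarrow> real"
  assumes "((\<lambda>s. F (x + s *\<^sub>R axis i 1)) has_real_derivative D) (at 0)"
  shows "partial_deriv i F x = D"
  unfolding partial_deriv_def by (rule DERIV_imp_deriv[OF assms])

text \<open>The right-hand side of Hamilton's equations; \<open>a\<close> and \<open>b\<close> are
  the momenta \<open>p(X)\<close> and \<open>p(Y)\<close>.\<close>

definition heis_hamilton_field :: "(real^3) \<times> (real^3) \<Rightarrow> (real^3) \<times> (real^3)" where
  "heis_hamilton_field w =
    (let q = fst w; p = snd w; a = p$1 - 1/2 * q$2 * p$3; b = p$2 + 1/2 * q$1 * p$3 in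
      (heis_frame q (Complex a b), vector [- 1/2 * b * p$3, 1/2 * a * p$3, 0]))"

lemma hamilton_solution_heis_iff:
  assumes ip: "\<And>q z w. ip q (heis_frame q z) (heis_frame q w) = z \<bullet> w"
  shows "hamilton_solution (hamiltonian heis_H ip) I c \<longleftrightarrow>
    (\<forall>t\<in>I. (c has_vector_derivative heis_hamilton_field (c t)) (at t))"
proof -
  define h where "h = (\<lambda>(q :: real^3) (p :: real^3). 1/2 * ((p$1 - 1/2 * q$2 * p$3)\<^sup>2 + (p$2 + 1/2 * q$1 * p$3)\<^sup>2))"
  have dp: "partial_deriv 1 (h q) p = p$1 - 1/2 * q$2 * p$3"
    "partial_deriv 2 (h q) p = p$2 + 1/2 * q$1 * p$3"
    "partial_deriv 3 (h q) p = 1/2 * (q$1 * (p$2 + 1/2 * q$1 * p$3) - q$2 * (p$1 - 1/2 * q$2 * p$3))"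
    for q p :: "real^3"
    by (rule partial_deriv_eqI; simp add: h_def axis_def;
        auto intro!: derivative_eq_intros simp: field_simps)+
  have dq: "partial_deriv 1 (\<lambda>q. h q p) q = 1/2 * (p$2 + 1/2 * q$1 * p$3) * p$3"
    "partial_deriv 2 (\<lambda>q. h q p) q = - 1/2 * (p$1 - 1/2 * q$2 * p$3) * p$3"
    "partial_deriv 3 (\<lambda>q. h q p) q = 0"
    for q p :: "real^3"
    by (rule partial_deriv_eqI; simp add: h_def axis_def;
        auto intro!: derivative_eq_intros simp: field_simps)+
  have "(\<chi> i. partial_deriv i (h q) p, \<chi> i. - partial_deriv i (\<lambda>q. h q p) q)
      = heis_hamilton_field (q, p)" for q p
    by (simp add: heis_hamilton_field_def Let_def vec_eq_iff forall_3 vector_3 heis_frame_nth dp dq)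
  then show ?thesis
    unfolding hamilton_solution_def hamiltonian_heis[OF ip] h_def[symmetric] Let_def by simp
qed

text \<open>Subtracting \<open>k * s\<close> leaves a function with zero derivative, hence constant
  on an interval. This yields uniqueness of the Hamiltonian trajectory by integrating its components
  one after another.\<close>

lemma constant_derivative_imp_affine:
  fixes h :: "real \<Rightarrow> real"
  assumes "is_interval I" "0 \<in> I" "t \<in> I" "\<And>s. s \<in> I \<Longrightarrow> (h has_real_derivative k) (at s)"
  shows "h t = h 0 + k * t"
proof -
  have "((\<lambda>s. h s - k * s) has_real_derivative 0) (at s within I)" if "s \<in> I" for s
    using DERIV_diff[OF has_field_derivative_at_within[OF assms(4)[OF that]] DERIV_cmult_Id[of k]]
    by simp
  then obtain c where "h s - k * s = c" if "s \<in> I" for s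
    using has_field_derivative_zero_constant[of I "\<lambda>s. h s - k * s"] assms(1)
    by (metis is_interval_convex)
  from this[OF assms(2)] this[OF assms(3)] show ?thesis by simp
qed

lemma has_vector_derivative_components:
  fixes c :: "real \<Rightarrow> (real^'n) \<times> (real^'n)"
  assumes "(c has_vector_derivative d) (at t)"
  shows "((\<lambda>t. fst (c t) $ i) has_real_derivative fst d $ i) (at t)"
    and "((\<lambda>t. snd (c t) $ i) has_real_derivative snd d $ i) (at t)"
  using bounded_linear.has_vector_derivative[OF bounded_linear_compose[OF
        bounded_linear_vec_nth[of i] bounded_linear_fst] assms]
    bounded_linear.has_vector_derivative[OF bounded_linear_compose[OF
        bounded_linear_vec_nth[of i] bounded_linear_snd] assms]
  by (simp_all add: has_real_derivative_iff_has_vector_derivative)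

text \<open>The momentum \<open>p\<^sub>3\<close> is conserved; as it vanishes initially, the remaining equations
  decouple and the solution is a straight line.\<close>

lemma hamilton_flow_heis:
  assumes ip: "\<And>q z w. ip q (heis_frame q z) (heis_frame q w) = z \<bullet> w"
  shows "hamilton_flow (hamiltonian heis_H ip) t (x, vector [Re z, Im z, 0])
    = (x + t *\<^sub>R heis_frame x z, vector [Re z, Im z, 0])"
  unfolding hamilton_flow_def hamilton_solution_heis_iff[OF ip]
proof (rule the_equality)
  let ?c = "\<lambda>t. (x + t *\<^sub>R heis_frame x z, vector [Re z, Im z, 0] :: real^3)"
  have "(?c has_vector_derivative heis_hamilton_field (?c s)) (at s)" for s
  proof -
    \<comment> \<open>Along the line the terms in \<open>s\<close> cancel in the third component, so
      \<open>heis_frame\<close> assigns to \<open>z\<close> the same vector at all its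
      points.\<close>
    have "heis_hamilton_field (?c s) = (heis_frame x z, 0)"
      by (simp add: heis_hamilton_field_def Let_def vec_eq_iff forall_3 vector_3 heis_frame_nth algebra_simps)
    then show ?thesis
      by (auto intro!: derivative_eq_intros has_vector_derivative_Pair)
  qed
  then show "\<exists>I c. open I \<and> is_interval I \<and> 0 \<in> I \<and> t \<in> I \<and>
      (\<forall>t\<in>I. (c has_vector_derivative heis_hamilton_field (c t)) (at t)) \<and>
      c 0 = (x, vector [Re z, Im z, 0]) \<and> c t = ?c t"
    by (intro exI[of _ UNIV] exI[of _ ?c]) simp
next
  fix w
  assume "\<exists>I c. open I \<and> is_interval I \<and> 0 \<in> I \<and> t \<in> I \<and>
      (\<forall>t\<in>I. (c has_vector_derivative heis_hamilton_field (c t)) (at t)) \<and>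
      c 0 = (x, vector [Re z, Im z, 0]) \<and> c t = w"
  then obtain I c where I: "is_interval I" "0 \<in> I" "t \<in> I"
    and ode: "\<And>s. s \<in> I \<Longrightarrow> (c has_vector_derivative heis_hamilton_field (c s)) (at s)"
    and c0: "c 0 = (x, vector [Re z, Im z, 0])" and w: "c t = w"
    by blast
  note dq = has_vector_derivative_components(1)[OF ode]
  note dp = has_vector_derivative_components(2)[OF ode]
  note affine = constant_derivative_imp_affine[OF I(1,2)]
  note field = heis_hamilton_field_def Let_def vector_3 heis_frame_nth
  have p3: "snd (c s) $ 3 = 0" if "s \<in> I" for s
    using affine[OF that, of "\<lambda>s. snd (c s) $ 3" 0] dp[of _ 3] c0 by (simp add: field)
  have p1: "snd (c s) $ 1 = Re z" if "s \<in> I" for s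
    using affine[OF that, of "\<lambda>s. snd (c s) $ 1" 0] dp[of _ 1] c0 by (simp add: field p3)
  have p2: "snd (c s) $ 2 = Im z" if "s \<in> I" for s
    using affine[OF that, of "\<lambda>s. snd (c s) $ 2" 0] dp[of _ 2] c0 by (simp add: field p3)
  have q1: "fst (c s) $ 1 = x $ 1 + Re z * s" if "s \<in> I" for s
    using affine[OF that, of "\<lambda>s. fst (c s) $ 1" "Re z"] dq[of _ 1] c0
    by (simp add: field p3 p1)
  have q2: "fst (c s) $ 2 = x $ 2 + Im z * s" if "s \<in> I" for s
    using affine[OF that, of "\<lambda>s. fst (c s) $ 2" "Im z"] dq[of _ 2] c0
    by (simp add: field p3 p2)
  \<comment> \<open>The right-hand side is half of \<open>q1 * Im z - q2 * Re z\<close>; the linear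
    growth of \<open>q1\<close> and \<open>q2\<close> cancels and leaves a constant.\<close>
  have "((\<lambda>s. fst (c s) $ 3) has_real_derivative heis_frame x z $ 3) (at s)" if "s \<in> I" for s
    using dq[OF that, of 3] that
    by (simp add: field p1 p2 p3 q1 q2 algebra_simps)
  then have q3: "fst (c t) $ 3 = x $ 3 + heis_frame x z $ 3 * t"
    using affine[OF I(3), of "\<lambda>s. fst (c s) $ 3" "heis_frame x z $ 3"] c0 by simp
  have "fst (c t) = x + t *\<^sub>R heis_frame x z"
    using I(3) by (simp add: vec_eq_iff forall_3 q1 q2 q3 heis_frame_nth(1,2) mult.commute)
  moreover have "snd (c t) = vector [Re z, Im z, 0]"
    using I(3) by (simp add: vec_eq_iff forall_3 vector_3 p1 p2 p3)
  ultimately show "w = (x + t *\<^sub>R heis_frame x z, vector [Re z, Im z, 0])"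
    using w by (simp add: prod_eq_iff)
qed

section \<open>The covector of a horizontal vector\<close>

text \<open>Each coordinate vector is a frame vector plus a multiple of \<open>Z\<close>, or
  \<open>Z\<close> itself. Orthogonality to \<open>Z\<close> removes the \<open>Z\<close> parts, and
  the coefficients in \<open>X\<close> and \<open>Y\<close> remain.\<close>

lemma flat_heis_frame:
  assumes g: "inner_product_on UNIV (g x)"
    and XX: "g x (heis_X x) (heis_X x) = 1" and YY: "g x (heis_Y x) (heis_Y x) = 1"
    and XY: "g x (heis_X x) (heis_Y x) = 0"
    and XZ: "g x (heis_X x) (heis_Z x) = 0" and YZ: "g x (heis_Y x) (heis_Z x) = 0"
  shows "flat g x (heis_frame x z) = vector [Re z, Im z, 0]"
proof -
  have comm: "g x u v = g x v u" and add: "g x (u + v) w = g x u w + g x v w"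
    and scale: "g x (a *\<^sub>R u) w = a * g x u w" for u v w a
    using g unfolding inner_product_on_def by auto
  have e: "axis 3 1 = heis_Z x"
    "axis 1 1 = heis_X x + (1/2 * x$2) *\<^sub>R heis_Z x"
    "axis 2 1 = heis_Y x + (- x$1/2) *\<^sub>R heis_Z x"
    by (simp_all add: vec_eq_iff forall_3 axis_def heis_X_def heis_Y_def heis_Z_def vector_3)
  have right: "g x u (heis_frame x z) = Re z * g x u (heis_X x) + Im z * g x u (heis_Y x)" for u
    unfolding comm[of u] heis_frame_def by (simp only: add scale)
  have "g x (heis_Y x) (heis_X x) = 0" "g x (heis_Z x) (heis_X x) = 0" "g x (heis_Z x) (heis_Y x) = 0"
    using XY XZ YZ comm by metis+
  with XX YY XY show ?thesis
    unfolding flat_def vec_eq_iff forall_3 vec_lambda_beta e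
    by (simp add: add scale right vector_3 del: scaleR_minus_left)
qed

section \<open>Second derivatives along lines\<close>

definition second_deriv :: "('a::real_normed_vector \<Rightarrow> real) \<Rightarrow> 'a \<Rightarrow> 'a \<Rightarrow> 'a \<Rightarrow> real" where
  "second_deriv f x u v = frechet_derivative (\<lambda>y. frechet_derivative f (at y) u) (at x) v"

lemma smooth_fun_on_UNIV_D:
  assumes "smooth_fun_on UNIV f"
  shows "f differentiable (at x)" "(\<lambda>y. frechet_derivative f (at y) v) differentiable (at x)"
proof -
  have "Ck_on (Suc (Suc 0)) UNIV f" using assms unfolding smooth_fun_on_def by blast
  then show "f differentiable (at x)" "(\<lambda>y. frechet_derivative f (at y) v) differentiable (at x)"
    by simp_all
qed

lemma has_real_derivative_along_line:
  fixes f :: "'a::real_normed_vector \<Rightarrow> real"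
  assumes "f differentiable (at (x + t *\<^sub>R v))"
  shows "((\<lambda>t. f (x + t *\<^sub>R v)) has_real_derivative frechet_derivative f (at (x + t *\<^sub>R v)) v) (at t)"
proof -
  let ?D = "frechet_derivative f (at (x + t *\<^sub>R v))"
  have D: "(f has_derivative ?D) (at (x + t *\<^sub>R v))"
    using assms by (simp add: frechet_derivative_works)
  have "((\<lambda>t. x + t *\<^sub>R v) has_derivative (\<lambda>h. h *\<^sub>R v)) (at t)"
    by (auto intro!: derivative_eq_intros)
  from has_derivative_compose[OF this D] have "((\<lambda>t. f (x + t *\<^sub>R v)) has_derivative (\<lambda>h. ?D (h *\<^sub>R v))) (at t)" .
  moreover have "?D (h *\<^sub>R v) = ?D v * h" for h
    using linear_scale[OF has_derivative_linear[OF D]] by simp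
  ultimately show ?thesis
    by (simp add: has_field_derivative_def)
qed

text \<open>This is the integrand of the sub-Laplacian once the flow is known to project to a
  straight line. The inner derivative is the directional derivative at
  \<open>x + t *\<^sub>R v\<close>, and the outer one differentiates it along the same line.\<close>

lemma deriv_deriv_along_line:
  fixes f :: "'a::real_normed_vector \<Rightarrow> real"
  assumes f: "smooth_fun_on UNIV f"
  shows "deriv (\<lambda>t. deriv (\<lambda>s. f (x + (t + s) *\<^sub>R v)) 0) 0 = second_deriv f x v v"
proof -
  have "deriv (\<lambda>s. f (x + (t + s) *\<^sub>R v)) 0 = frechet_derivative f (at (x + t *\<^sub>R v)) v" for t
    using has_real_derivative_along_line[OF smooth_fun_on_UNIV_D(1)[OF f], where x="x + t *\<^sub>R v" and t=0 and v=v]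
    by (intro DERIV_imp_deriv) (simp add: algebra_simps)
  then show ?thesis
    using has_real_derivative_along_line[OF smooth_fun_on_UNIV_D(2)[OF f], where x=x and t=0 and v=v]
    by (simp add: second_deriv_def DERIV_imp_deriv)
qed

text \<open>In the last argument this is linearity of the outer derivative; in the other one the
  inner derivative is expanded at every point and the sum is then differentiated.\<close>

lemma second_deriv_linear:
  fixes f :: "'a::real_normed_vector \<Rightarrow> real"
  assumes f: "smooth_fun_on UNIV f"
  shows "second_deriv f x u (a *\<^sub>R v + b *\<^sub>R w) = a * second_deriv f x u v + b * second_deriv f x u w"
    and "second_deriv f x (a *\<^sub>R v + b *\<^sub>R w) u = a * second_deriv f x v u + b * second_deriv f x w u"
proof -
  note D = smooth_fun_on_UNIV_D[OF f]
  have "linear (second_deriv f x u)"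
    unfolding second_deriv_def[abs_def] by (intro linear_frechet_derivative D(2))
  then show "second_deriv f x u (a *\<^sub>R v + b *\<^sub>R w) = a * second_deriv f x u v + b * second_deriv f x u w"
    by (simp add: linear_add linear_scale)
  have "linear (frechet_derivative f (at y))" for y
    by (intro linear_frechet_derivative D(1))
  then have eq: "frechet_derivative f (at y) (a *\<^sub>R v + b *\<^sub>R w)
      = a * frechet_derivative f (at y) v + b * frechet_derivative f (at y) w" for y
    by (simp add: linear_add linear_scale)
  have "((\<lambda>y. a * frechet_derivative f (at y) v + b * frechet_derivative f (at y) w) has_derivative
     (\<lambda>u. a * second_deriv f x v u + b * second_deriv f x w u)) (at x)"
    using D(2)[of _ x] unfolding frechet_derivative_works second_deriv_def
    by (intro derivative_intros has_derivative_mult_right) auto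
  from fun_cong[OF frechet_derivative_at[OF this], of u]
  show "second_deriv f x (a *\<^sub>R v + b *\<^sub>R w) u = a * second_deriv f x v u + b * second_deriv f x w u"
    unfolding second_deriv_def[of f x "a *\<^sub>R v + b *\<^sub>R w"] eq by (rule sym)
qed

text \<open>The first-order part of \<open>V (V f)\<close> is the derivative of \<open>f\<close> along \<open>D V (V)\<close>,
  which vanishes for the left-invariant fields \<open>X\<close> and \<open>Y\<close>.\<close>

lemma lie_derivative_twice:
  fixes f :: "'a::real_normed_vector \<Rightarrow> real"
  assumes f: "smooth_fun_on UNIV f"
    and V: "\<And>y. V y = V x + l (y - x) *\<^sub>R e" and l: "bounded_linear l" "l (V x) = 0"
  shows "lie_derivative V (lie_derivative V f) x = second_deriv f x (V x) (V x)"
proof -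
  note D = smooth_fun_on_UNIV_D[OF f]
  have lin: "linear (frechet_derivative f (at y))" for y
    by (intro linear_frechet_derivative D(1))
  have "lie_derivative V f
      = (\<lambda>y. frechet_derivative f (at y) (V x) + l (y - x) * frechet_derivative f (at y) e)"
  proof
    fix y
    show "lie_derivative V f y
      = frechet_derivative f (at y) (V x) + l (y - x) * frechet_derivative f (at y) e"
      unfolding lie_derivative_def
      by (subst V) (simp add: linear_add[OF lin] linear_scale[OF lin])
  qed
  \<comment> \<open>In the product rule one term carries \<open>l (x - x)\<close> and the other,
    evaluated at \<open>V x\<close>, carries \<open>l (V x)\<close>; both vanish.\<close>
  moreover have "((\<lambda>y. frechet_derivative f (at y) (V x) + l (y - x) * frechet_derivative f (at y) e)
     has_derivative (\<lambda>u. second_deriv f x (V x) u +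
       (l (x - x) * second_deriv f x e u + l (u - 0) * frechet_derivative f (at x) e))) (at x)"
    using D(2)[of _ x] unfolding frechet_derivative_works second_deriv_def
    by (intro has_derivative_add has_derivative_mult bounded_linear.has_derivative[OF l(1)]
        has_derivative_diff has_derivative_ident has_derivative_const) auto
  note frechet_derivative_at[OF this, symmetric]
  ultimately show ?thesis
    unfolding lie_derivative_def[of V "lie_derivative V f"]
    using l by (simp add: linear_0 bounded_linear.linear)
qed

section \<open>Averaging over the horizontal circle\<close>

theorem mainTheorem6:
  fixes ip g :: "real^3 \<Rightarrow> real^3 \<Rightarrow> real^3 \<Rightarrow> real" and lam :: real and f :: "real^3 \<Rightarrow> real"
  assumes "sub_riemannian 2 heis_H ip"
    and "\<And>q. ip q (heis_X q) (heis_X q) = 1"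
    and "\<And>q. ip q (heis_Y q) (heis_Y q) = 1"
    and "\<And>q. ip q (heis_X q) (heis_Y q) = 0"
    and "lam > 0"
    and "riemannian_metric g"
    and "compatible heis_H ip g"
    and "\<And>q. g q (heis_X q) (heis_Y q) = 0"
    and "\<And>q. g q (heis_X q) (heis_Z q) = 0"
    and "\<And>q. g q (heis_Y q) (heis_Z q) = 0"
    and "\<And>q. g q (heis_Z q) (heis_Z q) = lam"
    and "f \<in> Cc_infinity"
  shows "horizontal_sublaplacian heis_H ip g f =
    (\<lambda>x. 1/2 * (lie_derivative heis_X (lie_derivative heis_X f) x
             + lie_derivative heis_Y (lie_derivative heis_Y f) x))"
proof
  fix x
  have ip: "ip q (heis_frame q z) (heis_frame q w) = z \<bullet> w" for q z w
    using assms(1-4) by (intro inner_product_on_heis_frame) (auto simp: sub_riemannian_def)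
  have f: "smooth_fun_on UNIV f" using assms(12) by (simp add: Cc_infinity_def)
  \<comment> \<open>Compatibility compares \<open>g\<close> with \<open>ip\<close> on horizontal
    vectors, so membership comes before the unit lengths are carried over to
    \<open>g\<close>.\<close>
  have "heis_X q \<in> heis_H q" "heis_Y q \<in> heis_H q" for q
    using heis_frame_in_H[of q 1] heis_frame_in_H[of q \<i>] by simp_all
  then have "g q (heis_X q) (heis_X q) = 1" "g q (heis_Y q) (heis_Y q) = 1" for q
    using assms(2,3,7) unfolding compatible_def by metis+
  then have flat: "flat g x (heis_frame x z) = vector [Re z, Im z, 0]" for z
    using assms(6,8-10) by (intro flat_heis_frame) (auto simp: riemannian_metric_def)
  let ?XX = "second_deriv f x (heis_X x) (heis_X x)" and ?XY = "second_deriv f x (heis_X x) (heis_Y x)"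
  let ?YX = "second_deriv f x (heis_Y x) (heis_X x)" and ?YY = "second_deriv f x (heis_Y x) (heis_Y x)"
  \<comment> \<open>Both mixed derivatives share the coefficient \<open>Re z * Im z\<close>, whose
    mean is zero, while the squares have mean \<open>1/2\<close>.\<close>
  let ?Q = "\<lambda>z. (Re z)\<^sup>2 * ?XX + Re z * Im z * (?XY + ?YX) + (Im z)\<^sup>2 * ?YY"
  have integrand: "deriv (\<lambda>t. deriv (\<lambda>s.
      f (fst (hamilton_flow (hamiltonian heis_H ip) (t + s) (x, flat g x v)))) 0) 0
    = ?Q (heis_coord v)" if "v \<in> space (heis_sphere_measure x)" for v
  proof -
    have "v \<in> heis_frame x ` sphere 0 1"
      using that sets_eq_imp_space_eq[OF sets_heis_sphere_measure] by (auto simp: space_restrict_space)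
    then obtain z where v: "v = heis_frame x z" by auto
    show ?thesis
      unfolding v flat hamilton_flow_heis[OF ip] fst_conv deriv_deriv_along_line[OF f] heis_coord_frame
      unfolding heis_frame_def second_deriv_linear[OF f]
      by (simp add: power2_eq_square algebra_simps)
  qed
  have "horizontal_sublaplacian heis_H ip g f x = (\<integral>v. ?Q (heis_coord v) \<partial>heis_sphere_measure x)"
    unfolding horizontal_sublaplacian_def uniform_on_sphere_heis[where ip=ip and x=x, OF ip]
    by (rule Bochner_Integration.integral_cong[OF refl integrand])
  also have "\<dots> = (\<integral>z. ?Q z \<partial>circle_measure)"
    by (subst integral_heis_sphere_measure) (simp_all)
  also have "\<dots> = 1/2 * (?XX + ?YY)"
    by (simp add: circle_measure_moments integrable_circle_measure continuous_intros)
  \<comment> \<open>\<open>X\<close> varies only with the second coordinate, at the rate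
    \<open>vector [0, 0, - 1/2]\<close>, and its own second component is zero. For \<open>Y\<close>
    below the first coordinate plays this part.\<close>
  also have "?XX = lie_derivative heis_X (lie_derivative heis_X f) x"
    by (rule lie_derivative_twice[OF f, of _ _ "\<lambda>v. v$2" "vector [0, 0, - 1/2]", symmetric])
      (auto simp: vec_eq_iff forall_3 vector_3 heis_X_def bounded_linear_vec_nth field_simps)
  also have "?YY = lie_derivative heis_Y (lie_derivative heis_Y f) x"
    by (rule lie_derivative_twice[OF f, of _ _ "\<lambda>v. v$1" "vector [0, 0, 1/2]", symmetric])
      (auto simp: vec_eq_iff forall_3 vector_3 heis_Y_def bounded_linear_vec_nth field_simps)
  finally show "horizontal_sublaplacian heis_H ip g f x =
    1/2 * (lie_derivative heis_X (lie_derivative heis_X f) x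
         + lie_derivative heis_Y (lie_derivative heis_Y f) x)" .
qed

end
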